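(* Let $\mathcal{F}$ be a finite set of graphs that contains a planar graph but contains no forest. Then there exist a constant $c = c(\mathcal{F}) > 0$ and an integer $k_0 = k_0(\mathcal{F})$ such that for every integer $k \geq k_0$ there is a graph $G$ with $\nu_{\mathcal{F}}(G) = k$ and $\tau_{\mathcal{F}}(G) \geq c\, k \log k$.
   Context: All graphs are finite, simple, and undirected. A graph $H$ is a minor of a graph $G$ if $H$ can be obtained from a subgraph of $G$ by contracting edges (loops and parallel edges created are deleted). For a finite set $\mathcal{F}$ of graphs and a graph $G$, $\nu_{\mathcal{F}}(G)$ is the maximum size of a collection of pairwise vertex-disjoint subgraphs of $G$, each containing some member of $\mathcal{F}$ as a minor; $\tau_{\mathcal{F}}(G)$ is the minimum size of a vertex subset $X \subseteq V(G)$ such that $G - X$ contains no member of $\mathcal{F}$ as a minor. *)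

theory Defs
  imports "HOL-Analysis.Analysis"
begin

record 'a ugraph =
  verts :: "'a set"
  edges :: "'a set set"

definition simple_graph :: "'a ugraph \<Rightarrow> bool" where
  "simple_graph G \<longleftrightarrow>
     finite (verts G) \<and> (\<forall>e\<in>edges G. e \<subseteq> verts G \<and> card e = 2)"

definition subgraph :: "'a ugraph \<Rightarrow> 'a ugraph \<Rightarrow> bool" where
  "subgraph H G \<longleftrightarrow>
     simple_graph H \<and> simple_graph G \<and> verts H \<subseteq> verts G \<and> edges H \<subseteq> edges G"

definition delete_verts :: "'a ugraph \<Rightarrow> 'a set \<Rightarrow> 'a ugraph" where
  "delete_verts G X =
     \<lparr> verts = verts G - X, edges = {e \<in> edges G. e \<inter> X = {}} \<rparr>"

definition isomorphic :: "'a ugraph \<Rightarrow> 'b ugraph \<Rightarrow> bool" where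
  "isomorphic G H \<longleftrightarrow>
     (\<exists>f. bij_betw f (verts G) (verts H) \<and> edges H = (\<lambda>e. f ` e) ` edges G)"

(* The edge uv is contracted onto its end u. Parallel edges collapse because the
   edges form a set; the loop arising from uv becomes a singleton and is dropped. *)
definition contract_edge :: "'a ugraph \<Rightarrow> 'a \<Rightarrow> 'a \<Rightarrow> 'a ugraph" where
  "contract_edge G u v =
     \<lparr> verts = verts G - {v},
       edges = {e \<in> (\<lambda>e. (id(v := u)) ` e) ` edges G. card e = 2} \<rparr>"

definition contraction_step :: "'a ugraph \<Rightarrow> 'a ugraph \<Rightarrow> bool" where
  "contraction_step G K \<longleftrightarrow> (\<exists>u v. {u, v} \<in> edges G \<and> u \<noteq> v \<and> K = contract_edge G u v)"

definition is_minor :: "'a ugraph \<Rightarrow> 'b ugraph \<Rightarrow> bool" where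
  "is_minor H G \<longleftrightarrow>
     (\<exists>G' K. subgraph G' G \<and> contraction_step\<^sup>*\<^sup>* G' K \<and> isomorphic K H)"

definition is_cycle :: "'a ugraph \<Rightarrow> 'a list \<Rightarrow> bool" where
  "is_cycle G vs \<longleftrightarrow>
     length vs \<ge> 3 \<and> distinct vs \<and> set vs \<subseteq> verts G \<and>
     (\<forall>i<length vs. {vs ! i, vs ! (Suc i mod length vs)} \<in> edges G)"

definition forest :: "'a ugraph \<Rightarrow> bool" where
  "forest G \<longleftrightarrow> simple_graph G \<and> (\<nexists>vs. is_cycle G vs)"

(* Planarity in the topological sense, with the complex numbers as the plane:
   p places the vertices and \<gamma> e is the arc drawn for the edge e. *)
definition planar :: "'a ugraph \<Rightarrow> bool" where
  "planar G \<longleftrightarrow> simple_graph G \<and>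
     (\<exists>(p :: 'a \<Rightarrow> complex) (\<gamma> :: 'a set \<Rightarrow> real \<Rightarrow> complex).
        inj_on p (verts G) \<and>
        (\<forall>e\<in>edges G. arc (\<gamma> e) \<and>
           {pathstart (\<gamma> e), pathfinish (\<gamma> e)} = p ` e \<and>
           path_image (\<gamma> e) \<inter> p ` verts G = p ` e) \<and>
        (\<forall>e\<in>edges G. \<forall>e'\<in>edges G. e \<noteq> e' \<longrightarrow>
           path_image (\<gamma> e) \<inter> path_image (\<gamma> e') \<subseteq> p ` (e \<inter> e')))"

definition has_minor_from :: "'a ugraph set \<Rightarrow> 'b ugraph \<Rightarrow> bool" where
  "has_minor_from \<F> G \<longleftrightarrow> (\<exists>H\<in>\<F>. is_minor H G)"

definition packing :: "'a ugraph set \<Rightarrow> 'b ugraph \<Rightarrow> 'b ugraph set \<Rightarrow> bool" where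
  "packing \<F> G P \<longleftrightarrow>
     (\<forall>K\<in>P. subgraph K G \<and> has_minor_from \<F> K) \<and>
     (\<forall>K\<in>P. \<forall>L\<in>P. K \<noteq> L \<longrightarrow> verts K \<inter> verts L = {})"

definition hitting_set :: "'a ugraph set \<Rightarrow> 'b ugraph \<Rightarrow> 'b set \<Rightarrow> bool" where
  "hitting_set \<F> G X \<longleftrightarrow> X \<subseteq> verts G \<and> \<not> has_minor_from \<F> (delete_verts G X)"

(* A finite graph has finitely many subgraphs, so the Max ranges over a finite set
   (containing 0). The Min ranges over a nonempty set as soon as the family does not
   contain the graph without vertices. *)
definition packing_number :: "'a ugraph set \<Rightarrow> 'b ugraph \<Rightarrow> nat" where
  "packing_number \<F> G = Max {card P | P. packing \<F> G P}"

definition covering_number :: "'a ugraph set \<Rightarrow> 'b ugraph \<Rightarrow> nat" where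
  "covering_number \<F> G = Min {card X | X. hitting_set \<F> G X}"

end

theory Submission
  imports Defs
begin

text \<open>
  A host graph is needed in which cycles are scarce, so that little can be packed, while deleting
  few vertices never destroys a fixed minor. A sparse random graph is both.

  Fix a member \<^term>\<open>H\<close> of the family, with \<^term>\<open>t\<close> vertices, and take \<^term>\<open>n\<close> vertices
  with a suitable constant average degree depending on \<^term>\<open>t\<close>. With high probability any two
  disjoint vertex sets of size \<^term>\<open>s\<close> are joined by an edge, where \<^term>\<open>s\<close> is a small
  fraction of \<^term>\<open>n\<close>. Under this condition every set of \<^term>\<open>3 * s\<close> vertices contains a
  connected set of size \<^term>\<open>s\<close>; hence any \<^term>\<open>n / 2\<close> vertices contain \<^term>\<open>t\<close>
  disjoint connected sets of this size, and these are pairwise joined. Contracting them gives a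
  complete minor on \<^term>\<open>t\<close> vertices, hence an \<^term>\<open>H\<close> minor, so that at least
  \<^term>\<open>n / 2\<close> vertices must be deleted (\<open>minor_after_deletion\<close>).

  On the other hand, no member of the family is a forest, so every member of a packing contains a
  cycle. In a sparse random graph the expected number of cycles of length at most \<^term>\<open>l\<close> is
  small when \<^term>\<open>l\<close> is a small multiple of \<^term>\<open>ln n\<close>, and at most \<^term>\<open>n / l\<close> disjoint
  subgraphs can have more than \<^term>\<open>l\<close> vertices. Packings therefore have size of order
  \<^term>\<open>n / ln n\<close> (\<open>packing_le_short_cycles\<close>), while covers have size of order \<^term>\<open>n\<close>. A
  union bound for the holes and an average for the short cycles produce one graph with both
  properties (\<open>sparse_hole_free_graph_exists\<close>).

  This bounds the packing number by \<^term>\<open>k\<close> only from above. Equality is reached by adding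
  vertices one at a time: each raises the packing number by at most one, and covers do not get
  smaller (\<open>exact_packing_number\<close>).
\<close>

section \<open>Cycles survive in the host of a minor\<close>

lemma is_cycle_iff_successively:
  "is_cycle G vs \<longleftrightarrow> 3 \<le> length vs \<and> distinct vs \<and> set vs \<subseteq> verts G \<and>
     successively (\<lambda>a b. {a, b} \<in> edges G) vs \<and> {last vs, hd vs} \<in> edges G"
proof (cases "3 \<le> length vs")
  case True
  then have ne: "vs \<noteq> []" by auto
  have "(\<forall>i<length vs. {vs ! i, vs ! (Suc i mod length vs)} \<in> edges G) \<longleftrightarrow>
        (\<forall>i. Suc i < length vs \<longrightarrow> {vs ! i, vs ! Suc i} \<in> edges G) \<and> {last vs, hd vs} \<in> edges G"
    (is "?L \<longleftrightarrow> ?R")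
  proof
    assume L: ?L
    have "{vs ! i, vs ! Suc i} \<in> edges G" if "Suc i < length vs" for i
      using L[rule_format, of i] that by simp
    moreover have "{last vs, hd vs} \<in> edges G"
      using L[rule_format, of "length vs - 1"] ne by (simp add: last_conv_nth hd_conv_nth)
    ultimately show ?R by blast
  next
    assume R: ?R
    show ?L
    proof (intro allI impI)
      fix i assume i: "i < length vs"
      show "{vs ! i, vs ! (Suc i mod length vs)} \<in> edges G"
      proof (cases "Suc i < length vs")
        case True
        then show ?thesis using R by simp
      next
        case False
        then have "Suc i = length vs" using i by simp
        moreover from this have "i = length vs - 1" by simp
        ultimately show ?thesis using R ne by (simp add: last_conv_nth hd_conv_nth)
      qed
    qed
  qed
  then show ?thesis by (auto simp: is_cycle_def successively_conv_nth)
qed (auto simp: is_cycle_def)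

lemma is_cycle_rotate:
  assumes "is_cycle G (xs @ ys)"
  shows "is_cycle G (ys @ xs)"
  using assms unfolding is_cycle_iff_successively
  by (cases "xs = []"; cases "ys = []") (auto simp: successively_append_iff)

lemma is_cycle_subgraph:
  assumes "subgraph K G" "is_cycle K vs"
  shows "is_cycle G vs"
  using assms unfolding is_cycle_def subgraph_def by blast

lemma contract_edge_adjD:
  assumes "simple_graph G" "u \<noteq> v" "{a, b} \<in> edges (contract_edge G u v)"
  obtains a' b' where "{a', b'} \<in> edges G" "(id(v := u)) a' = a" "(id(v := u)) b' = b"
proof -
  obtain e where e: "e \<in> edges G" "id(v := u) ` e = {a, b}" and c: "card {a, b} = 2"
    using assms(3) unfolding contract_edge_def by auto
  obtain x y where xy: "e = {x, y}"
    using assms(1) e(1) unfolding simple_graph_def by (meson card_2_iff)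
  have "{(id(v := u)) x, (id(v := u)) y} = {a, b}"
    using e(2) unfolding xy by (simp only: image_insert image_empty)
  then consider "(id(v := u)) x = a" "(id(v := u)) y = b" | "(id(v := u)) x = b" "(id(v := u)) y = a"
    by (metis doubleton_eq_iff)
  then show ?thesis
  proof cases
    case 1
    then show ?thesis using that[of x y] e xy by simp
  next
    case 2
    then show ?thesis using that[of y x] e xy by (simp add: insert_commute)
  qed
qed

lemma simple_graph_contract_edge:
  assumes "simple_graph G" "{u, v} \<in> edges G" "u \<noteq> v"
  shows "simple_graph (contract_edge G u v)"
  using assms unfolding simple_graph_def contract_edge_def
  by (fastforce simp: image_def)

text \<open>
  If a cycle of the contracted graph passes through the merged vertex, its two neighbours there
  are adjacent to \<^term>\<open>u\<close> or \<^term>\<open>v\<close> in the original graph. When they can use the same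
  end, the cycle lifts with its length; otherwise it is lengthened by the edge \<open>uv\<close>.
\<close>
lemma cycle_of_contract_edge:
  assumes G: "simple_graph G" and uv: "{u, v} \<in> edges G" "u \<noteq> v"
    and cyc: "is_cycle (contract_edge G u v) vs"
  shows "\<exists>ws. is_cycle G ws"
proof (cases "u \<in> set vs")
  case False
  have sub: "set vs \<subseteq> verts G - {v}" using cyc by (auto simp: is_cycle_def contract_edge_def)
  have lift: "{a, b} \<in> edges G" if ab: "{a, b} \<in> edges (contract_edge G u v)" "a \<in> set vs" "b \<in> set vs" for a b
  proof -
    obtain a' b' where *: "{a', b'} \<in> edges G" "(id(v := u)) a' = a" "(id(v := u)) b' = b"
      using contract_edge_adjD[OF G uv(2) ab(1)] .
    have "a' = a" "b' = b" using * ab False by (auto split: if_splits)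
    then show ?thesis using * by simp
  qed
  have "is_cycle G vs"
    unfolding is_cycle_def
  proof (intro conjI allI impI)
    show "3 \<le> length vs" "distinct vs" using cyc by (auto simp: is_cycle_def)
    show "set vs \<subseteq> verts G" using sub by auto
    fix i assume i: "i < length vs"
    then have "Suc i mod length vs < length vs" by (intro mod_less_divisor) auto
    then show "{vs ! i, vs ! (Suc i mod length vs)} \<in> edges G"
      using cyc i by (intro lift) (auto simp: is_cycle_def)
  qed
  then show ?thesis ..
next
  case True
  then obtain xs ys where vs: "vs = xs @ u # ys" by (meson split_list)
  define zs where "zs = ys @ xs"
  have cyc': "is_cycle (contract_edge G u v) (u # zs)"
    using is_cycle_rotate[of _ xs "u # ys"] cyc vs by (simp add: zs_def)
  have len: "2 \<le> length zs" and dist: "distinct zs" "u \<notin> set zs"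
    and sub: "set zs \<subseteq> verts G - {v}"
    and suc: "successively (\<lambda>a b. {a, b} \<in> edges (contract_edge G u v)) (u # zs)"
    and lst: "{last (u # zs), u} \<in> edges (contract_edge G u v)"
    using cyc' by (auto simp: is_cycle_iff_successively contract_edge_def)
  have ne: "zs \<noteq> []" using len by auto
  have lift: "{a, b} \<in> edges G" if ab: "{a, b} \<in> edges (contract_edge G u v)" "a \<in> set zs" "b \<in> set zs" for a b
  proof -
    obtain a' b' where *: "{a', b'} \<in> edges G" "(id(v := u)) a' = a" "(id(v := u)) b' = b"
      using contract_edge_adjD[OF G uv(2) ab(1)] .
    have "a' = a" "b' = b" using * ab dist by (auto split: if_splits)
    then show ?thesis using * by simp
  qed
  have sucz: "successively (\<lambda>a b. {a, b} \<in> edges G) zs"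
  proof (rule successively_mono)
    show "successively (\<lambda>a b. {a, b} \<in> edges (contract_edge G u v)) zs"
      using suc ne by (simp add: successively_Cons)
  qed (rule lift)
  have end_lift: "\<exists>p\<in>{u, v}. {p, x} \<in> edges G"
    if ux: "{u, x} \<in> edges (contract_edge G u v)" "x \<in> set zs" for x
  proof -
    obtain a' b' where *: "{a', b'} \<in> edges G" "(id(v := u)) a' = u" "(id(v := u)) b' = x"
      using contract_edge_adjD[OF G uv(2) ux(1)] .
    have "b' = x" using * ux dist by (auto split: if_splits)
    moreover have "a' \<in> {u, v}" using * by (auto split: if_splits)
    ultimately show ?thesis using * by blast
  qed
  have "{u, hd zs} \<in> edges (contract_edge G u v)" using suc ne by (auto simp: successively_Cons)
  then obtain p where p: "p \<in> {u, v}" "{p, hd zs} \<in> edges G" using end_lift ne by fastforce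
  have "{u, last zs} \<in> edges (contract_edge G u v)" using lst ne by (simp add: insert_commute)
  then obtain r where r: "r \<in> {u, v}" "{r, last zs} \<in> edges G" using end_lift ne by fastforce
  have uvV: "u \<in> verts G" "v \<in> verts G" using G uv(1) by (auto simp: simple_graph_def)
  have pr: "p \<notin> set zs" "r \<notin> set zs" "p \<in> verts G" "r \<in> verts G" using p r dist sub uvV by auto
  show ?thesis
  proof (cases "p = r")
    case True
    have "is_cycle G (p # zs)"
      unfolding is_cycle_iff_successively
      using len dist pr sub sucz p r True ne by (auto simp: successively_Cons insert_commute)
    then show ?thesis ..
  next
    case False
    then have "{r, p} = {u, v}" using p r by auto
    then have "{r, p} \<in> edges G" using uv by simp
    then have "is_cycle G (p # zs @ [r])"
      unfolding is_cycle_iff_successively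
      using len dist pr sub sucz p r False ne
      by (auto simp: successively_Cons successively_append_iff insert_commute)
    then show ?thesis ..
  qed
qed

lemma cycle_of_contractions:
  assumes "contraction_step\<^sup>*\<^sup>* G K" "simple_graph G"
  shows "simple_graph K \<and> ((\<exists>vs. is_cycle K vs) \<longrightarrow> (\<exists>vs. is_cycle G vs))"
  using assms(1)
proof induction
  case base
  show ?case using assms(2) by auto
next
  case (step K L)
  then show ?case
    unfolding contraction_step_def
    by (metis simple_graph_contract_edge cycle_of_contract_edge)
qed

lemma is_cycle_isomorphic:
  assumes iso: "isomorphic K H" and K: "simple_graph K" and cyc: "is_cycle H vs"
  shows "\<exists>ws. is_cycle K ws"
proof -
  obtain f where f: "bij_betw f (verts K) (verts H)" and E: "edges H = (\<lambda>e. f ` e) ` edges K"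
    using iso unfolding isomorphic_def by auto
  define g where "g = inv_into (verts K) f"
  have vsH: "set vs \<subseteq> verts H" using cyc by (auto simp: is_cycle_def)
  have g: "g ` set vs \<subseteq> verts K" "\<And>x. x \<in> set vs \<Longrightarrow> f (g x) = x" "inj_on g (set vs)"
    using f vsH bij_betw_inv_into[OF f] unfolding g_def
    by (auto simp: bij_betw_def f_inv_into_f inj_on_subset intro: inv_into_into)
  have lift: "{g a, g b} \<in> edges K" if ab: "{a, b} \<in> edges H" "a \<in> set vs" "b \<in> set vs" for a b
  proof -
    obtain e where e: "e \<in> edges K" "f ` e = {a, b}" using ab(1) unfolding E by auto
    have "f ` e = f ` {g a, g b}" using e ab g by simp
    moreover have "e \<subseteq> verts K" using K e by (auto simp: simple_graph_def)
    moreover have "{g a, g b} \<subseteq> verts K" using g ab by auto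
    ultimately have "e = {g a, g b}" using f unfolding bij_betw_def
      by (metis inj_on_image_eq_iff)
    then show ?thesis using e by simp
  qed
  have "is_cycle K (map g vs)"
    unfolding is_cycle_def
  proof (intro conjI allI impI)
    show "3 \<le> length (map g vs)" "distinct (map g vs)" "set (map g vs) \<subseteq> verts K"
      using cyc g by (auto simp: is_cycle_def distinct_map)
    fix i assume i: "i < length (map g vs)"
    then have j: "Suc i mod length vs < length vs" by (intro mod_less_divisor) auto
    then show "{map g vs ! i, map g vs ! (Suc i mod length (map g vs))} \<in> edges K"
      using cyc i lift[of "vs ! i" "vs ! (Suc i mod length vs)"] by (auto simp: is_cycle_def)
  qed
  then show ?thesis ..
qed

lemma cycle_of_minor:
  assumes "is_minor H G" "simple_graph H" "\<not> forest H"
  shows "\<exists>vs. is_cycle G vs"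
proof -
  obtain G' K where *: "subgraph G' G" "contraction_step\<^sup>*\<^sup>* G' K" "isomorphic K H"
    using assms(1) unfolding is_minor_def by blast
  obtain vs where "is_cycle H vs" using assms(2,3) unfolding forest_def by auto
  moreover have "simple_graph G'" using * by (simp add: subgraph_def)
  ultimately show ?thesis
    using * by (meson cycle_of_contractions is_cycle_isomorphic is_cycle_subgraph)
qed

section \<open>Minors from branch sets\<close>

lemma subgraph_trans:
  assumes "subgraph A B" "subgraph B C"
  shows "subgraph A C"
  using assms unfolding subgraph_def by blast

lemma is_minor_subgraph:
  assumes "is_minor H K" "subgraph K G"
  shows "is_minor H G"
  using assms subgraph_trans unfolding is_minor_def by blast

text \<open>
  Connectedness of a vertex set is expressed through cuts, because a cut of a contracted graph
  pulls back to a cut of the original one without any surgery on paths.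
\<close>
definition cut_connected :: "'a ugraph \<Rightarrow> 'a set \<Rightarrow> bool" where
  "cut_connected G B \<longleftrightarrow>
     (\<forall>S\<subseteq>B. S \<noteq> {} \<longrightarrow> S \<noteq> B \<longrightarrow> (\<exists>x\<in>S. \<exists>y\<in>B - S. {x, y} \<in> edges G))"

lemma cut_connected_singleton: "cut_connected G {x}"
  unfolding cut_connected_def by auto

lemma cut_connected_mono:
  assumes "cut_connected G B"
    and edge: "\<And>a b. a \<in> B \<Longrightarrow> b \<in> B \<Longrightarrow> {a, b} \<in> edges G \<Longrightarrow> {a, b} \<in> edges K"
  shows "cut_connected K B"
  unfolding cut_connected_def
proof (intro allI impI)
  fix S assume S: "S \<subseteq> B" "S \<noteq> {}" "S \<noteq> B"
  then obtain x y where "x \<in> S" "y \<in> B - S" "{x, y} \<in> edges G"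
    using assms(1) unfolding cut_connected_def by blast
  then show "\<exists>x\<in>S. \<exists>y\<in>B - S. {x, y} \<in> edges K" using edge[of x y] S(1) by blast
qed

lemma cut_connected_insert:
  assumes "cut_connected G B" "b \<in> B" "{b, y} \<in> edges G"
  shows "cut_connected G (insert y B)"
proof (cases "y \<in> B")
  case True
  then show ?thesis using assms by (simp add: insert_absorb)
next
  case y: False
  show ?thesis
    unfolding cut_connected_def
  proof (intro allI impI)
    fix S assume S: "S \<subseteq> insert y B" "S \<noteq> {}" "S \<noteq> insert y B"
    show "\<exists>x\<in>S. \<exists>z\<in>insert y B - S. {x, z} \<in> edges G"
    proof (cases "S \<inter> B = {} \<or> S \<inter> B = B")
      case True
      then consider "S = {y}" | "S = B" using S by blast
      then show ?thesis
        using assms(2,3) y by cases (auto simp: insert_commute)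
    next
      case False
      then obtain x z where "x \<in> S \<inter> B" "z \<in> B - S \<inter> B" "{x, z} \<in> edges G"
        using assms(1) unfolding cut_connected_def by (metis Int_lower2)
      then show ?thesis by blast
    qed
  qed
qed

lemma cut_connected_contract_edge:
  assumes B: "cut_connected G B" and uv: "u \<noteq> v" "u \<in> B \<longleftrightarrow> v \<in> B"
  shows "cut_connected (contract_edge G u v) (B - {v})"
  unfolding cut_connected_def
proof (intro allI impI)
  fix S assume S: "S \<subseteq> B - {v}" "S \<noteq> {}" "S \<noteq> B - {v}"
  define S' where "S' = {x \<in> B. (id(v := u)) x \<in> S}"
  have "S' \<subseteq> B" "S' \<noteq> {}" "S' \<noteq> B" using S uv by (auto simp: S'_def)
  then obtain x y where xy: "x \<in> S'" "y \<in> B - S'" "{x, y} \<in> edges G"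
    using B unfolding cut_connected_def by blast
  define x' y' where "x' = (id(v := u)) x" and "y' = (id(v := u)) y"
  have x'y': "x' \<in> S" "y' \<in> B - {v} - S" using xy uv by (auto simp: S'_def x'_def y'_def)
  moreover have "{x', y'} \<in> edges (contract_edge G u v)"
  proof -
    have "{x', y'} = id(v := u) ` {x, y}" by (simp add: x'_def y'_def)
    moreover have "x' \<noteq> y'" using x'y' by blast
    then have "card {x', y'} = 2" by simp
    ultimately show ?thesis using xy(3) unfolding contract_edge_def by auto
  qed
  ultimately show "\<exists>x\<in>S. \<exists>y\<in>B - {v} - S. {x, y} \<in> edges (contract_edge G u v)" by blast
qed

text \<open>
  A quotient map with connected fibres is realised by contracting, one after the other, edges
  inside the fibres; such an edge exists as long as the map is not injective.
\<close>
lemma contractions_onto_quotient: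
  assumes "simple_graph G" "r ` verts G = verts H"
    and "\<forall>x. cut_connected G {v \<in> verts G. r v = x}"
    and "edges H = {e \<in> (\<lambda>e. r ` e) ` edges G. card e = 2}"
  shows "\<exists>K. contraction_step\<^sup>*\<^sup>* G K \<and> isomorphic K H"
  using assms
proof (induction "card (verts G)" arbitrary: G rule: less_induct)
  case less
  have fin: "finite (verts G)" using less.prems(1) by (simp add: simple_graph_def)
  show ?case
  proof (cases "inj_on r (verts G)")
    case True
    have "card (r ` e) = 2" if "e \<in> edges G" for e
      using that less.prems(1) True unfolding simple_graph_def
      by (metis card_image inj_on_subset)
    then have "edges H = (\<lambda>e. r ` e) ` edges G" using less.prems(4) by auto
    then have "isomorphic G H" using True less.prems(2) by (auto simp: isomorphic_def bij_betw_def)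
    then show ?thesis by blast
  next
    case False
    then obtain a b where ab: "a \<in> verts G" "b \<in> verts G" "r a = r b" "a \<noteq> b"
      by (auto simp: inj_on_def)
    define F where "F = {v \<in> verts G. r v = r a}"
    have "{a} \<subseteq> F" "{a} \<noteq> {}" "{a} \<noteq> F" using ab by (auto simp: F_def)
    moreover have "cut_connected G F" using less.prems(3) by (simp add: F_def)
    ultimately obtain v where "v \<in> F - {a}" "{a, v} \<in> edges G"
      unfolding cut_connected_def by blast
    then have v: "v \<in> verts G" "r v = r a" "v \<noteq> a" "{a, v} \<in> edges G" by (auto simp: F_def)
    define K where "K = contract_edge G a v"
    have rid: "r ((id(v := a)) x) = r x" for x using v by simp
    have "\<exists>L. contraction_step\<^sup>*\<^sup>* K L \<and> isomorphic L H"
    proof (rule less.hyps)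
      show "card (verts K) < card (verts G)"
        using v fin unfolding K_def contract_edge_def by (simp only: ugraph.simps card_Diff1_less)
      show "simple_graph K"
        unfolding K_def using less.prems(1) v by (intro simple_graph_contract_edge) auto
      show "r ` verts K = verts H"
        using less.prems(2) v ab(1) by (auto simp: K_def contract_edge_def)
      show "\<forall>x. cut_connected K {w \<in> verts K. r w = x}"
      proof
        fix x
        have "{w \<in> verts K. r w = x} = {w \<in> verts G. r w = x} - {v}"
          by (auto simp: K_def contract_edge_def)
        moreover have "cut_connected K ({w \<in> verts G. r w = x} - {v})"
          unfolding K_def using less.prems(3) v ab(1) by (intro cut_connected_contract_edge) auto
        ultimately show "cut_connected K {w \<in> verts K. r w = x}" by simp
      qed
      have img: "r ` (id(v := a) ` e) = r ` e" for e
        using rid by (simp only: image_image)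
      have card2: "card (id(v := a) ` e) = 2" if "e \<in> edges G" "card (r ` e) = 2" for e
      proof (rule antisym)
        have e: "card e = 2" "finite e"
          using that less.prems(1) fin by (auto simp: simple_graph_def intro: finite_subset)
        show "card (id(v := a) ` e) \<le> 2" using card_image_le[OF e(2), of "id(v := a)"] e by simp
        show "2 \<le> card (id(v := a) ` e)"
          using card_image_le[of "id(v := a) ` e" r] e that by (simp only: img) simp
      qed
      show "edges H = {e \<in> (\<lambda>e. r ` e) ` edges K. card e = 2}"
      proof (intro set_eqI iffI)
        fix f assume "f \<in> edges H"
        then obtain e where e: "e \<in> edges G" "f = r ` e" "card (r ` e) = 2"
          using less.prems(4) by auto
        have "id(v := a) ` e \<in> edges K" using card2 e by (auto simp: K_def contract_edge_def)
        then show "f \<in> {e \<in> (\<lambda>e. r ` e) ` edges K. card e = 2}" using e img[of e] by blast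
      next
        fix f assume "f \<in> {e \<in> (\<lambda>e. r ` e) ` edges K. card e = 2}"
        then obtain e where e: "e \<in> edges G" "f = r ` (id(v := a) ` e)" "card f = 2"
          by (auto simp: K_def contract_edge_def)
        then show "f \<in> edges H" using less.prems(4) img[of e] by auto
      qed
    qed
    moreover have "contraction_step G K"
      unfolding contraction_step_def K_def using v by blast
    ultimately show ?thesis by (meson converse_rtranclp_into_rtranclp)
  qed
qed

lemma is_minor_of_branch_sets:
  fixes H :: "'a ugraph" and G :: "'b ugraph"
  assumes G: "simple_graph G" and H: "simple_graph H"
    and B: "\<And>x. x \<in> verts H \<Longrightarrow> B x \<subseteq> verts G \<and> B x \<noteq> {} \<and> cut_connected G (B x)"
    and disj: "\<And>x y. x \<in> verts H \<Longrightarrow> y \<in> verts H \<Longrightarrow> x \<noteq> y \<Longrightarrow> B x \<inter> B y = {}"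
    and adj: "\<And>x y. {x, y} \<in> edges H \<Longrightarrow> \<exists>a\<in>B x. \<exists>b\<in>B y. {a, b} \<in> edges G"
  shows "is_minor H G"
proof -
  define r where "r w = (SOME x. x \<in> verts H \<and> w \<in> B x)" for w
  have r: "r w = x" if "x \<in> verts H" "w \<in> B x" for w x
  proof -
    have "r w \<in> verts H \<and> w \<in> B (r w)" unfolding r_def using that by (intro someI) auto
    then show ?thesis using disj that by blast
  qed
  define G' where "G' = \<lparr> verts = (\<Union>x\<in>verts H. B x),
      edges = {e \<in> edges G. e \<subseteq> (\<Union>x\<in>verts H. B x) \<and> (card (r ` e) = 2 \<longrightarrow> r ` e \<in> edges H)} \<rparr>"
  have "simple_graph G'"
    using G B unfolding simple_graph_def G'_def by (auto intro: finite_subset)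
  then have sub: "subgraph G' G"
    using G B unfolding subgraph_def by (auto simp: G'_def)
  have fib: "{w \<in> verts G'. r w = x} = (if x \<in> verts H then B x else {})" for x
    using r by (auto simp: G'_def)
  have "\<exists>K. contraction_step\<^sup>*\<^sup>* G' K \<and> isomorphic K H"
  proof (rule contractions_onto_quotient)
    show "simple_graph G'" by fact
    show "r ` verts G' = verts H"
    proof
      show "r ` verts G' \<subseteq> verts H" using r by (auto simp: G'_def)
      show "verts H \<subseteq> r ` verts G'"
      proof
        fix x assume x: "x \<in> verts H"
        then obtain w where "w \<in> B x" using B by blast
        then show "x \<in> r ` verts G'" using x r[of x w] by (auto simp: G'_def image_iff)
      qed
    qed
    show "\<forall>x. cut_connected G' {w \<in> verts G'. r w = x}"
    proof
      fix x
      show "cut_connected G' {w \<in> verts G'. r w = x}"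
      proof (cases "x \<in> verts H")
        case True
        have "{a, b} \<in> edges G'" if "a \<in> B x" "b \<in> B x" "{a, b} \<in> edges G" for a b
          using that True r[of x a] r[of x b] by (auto simp: G'_def)
        moreover have "cut_connected G (B x)" using B True by blast
        ultimately show ?thesis
          using True unfolding fib by (simp add: cut_connected_mono)
      qed (auto simp: fib cut_connected_def)
    qed
    show "edges H = {e \<in> (\<lambda>e. r ` e) ` edges G'. card e = 2}"
    proof (intro set_eqI iffI)
      fix f assume f: "f \<in> edges H"
      then have f2: "card f = 2" "f \<subseteq> verts H" using H by (auto simp: simple_graph_def)
      then obtain x y where xy: "f = {x, y}" by (meson card_2_iff)
      then obtain a b where ab: "a \<in> B x" "b \<in> B y" "{a, b} \<in> edges G" using adj f by blast
      have "r ` {a, b} = f" using ab r f2 xy by auto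
      moreover from this have "{a, b} \<in> edges G'" using ab f f2 xy by (auto simp: G'_def)
      ultimately show "f \<in> {e \<in> (\<lambda>e. r ` e) ` edges G'. card e = 2}" using f2 by blast
    qed (auto simp: G'_def)
  qed
  then show ?thesis using sub unfolding is_minor_def by blast
qed

section \<open>Robust minors in graphs without bipartite holes\<close>

definition no_bipartite_hole :: "'a ugraph \<Rightarrow> nat \<Rightarrow> bool" where
  "no_bipartite_hole G s \<longleftrightarrow>
     (\<forall>A B. A \<subseteq> verts G \<longrightarrow> B \<subseteq> verts G \<longrightarrow> A \<inter> B = {} \<longrightarrow> card A = s \<longrightarrow> card B = s \<longrightarrow>
        (\<exists>a\<in>A. \<exists>b\<in>B. {a, b} \<in> edges G))"

text \<open>
  If growing a connected set from any vertex always got stuck before reaching size \<open>s\<close>, then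
  components of size below \<open>s\<close> could be collected until their union has between \<open>s\<close> and \<open>2s\<close>
  vertices. No edge leaves this union, while at least \<open>s\<close> vertices remain outside: a hole.
\<close>
lemma connected_set_of_size:
  assumes fin: "finite (verts G)" and hole: "no_bipartite_hole G s" and s: "0 < s"
    and W: "W \<subseteq> verts G" "3 * s \<le> card W"
  shows "\<exists>B\<subseteq>W. card B = s \<and> cut_connected G B"
proof -
  have finW: "finite W" using fin W finite_subset by blast
  define P where "P U \<longleftrightarrow> U \<subseteq> W \<and> (\<forall>x\<in>U. \<forall>y\<in>W - U. {x, y} \<notin> edges G) \<and> card U \<le> 2 * s" for U
  have "P {}" by (simp add: P_def)
  moreover have "\<forall>U. P U \<longrightarrow> card U < Suc (2 * s)" by (simp add: P_def)
  ultimately obtain U where U: "P U" and Umax: "\<And>U'. P U' \<Longrightarrow> card U' \<le> card U"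
    using ex_has_greatest_nat[of P "{}" card] by metis
  have UW: "U \<subseteq> W" "finite U" using U finW finite_subset by (auto simp: P_def)
  have cardWU: "card (W - U) = card W - card U" using UW by (simp add: card_Diff_subset)
  have small: "card U < s"
  proof (rule ccontr)
    assume "\<not> card U < s"
    then obtain A where A: "A \<subseteq> U" "card A = s" by (meson not_less obtain_subset_with_card_n)
    have "card U \<le> 2 * s" using U by (simp add: P_def)
    then have "s \<le> card (W - U)" using cardWU W(2) by linarith
    then obtain B where B: "B \<subseteq> W - U" "card B = s" by (meson obtain_subset_with_card_n)
    have "A \<subseteq> verts G" "B \<subseteq> verts G" "A \<inter> B = {}" using A B UW W by auto
    then have "\<exists>a\<in>A. \<exists>b\<in>B. {a, b} \<in> edges G"
      using hole A(2) B(2) unfolding no_bipartite_hole_def by simp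
    then show False using A B U unfolding P_def by blast
  qed
  then have "0 < card (W - U)" using cardWU W(2) by linarith
  then have "W - U \<noteq> {}" by (metis card.empty less_irrefl)
  then obtain x where x: "x \<in> W - U" by blast
  define Q where "Q B \<longleftrightarrow> B \<subseteq> W - U \<and> x \<in> B \<and> cut_connected G B \<and> card B \<le> s" for B
  have "Q {x}" using x s by (simp add: Q_def cut_connected_singleton)
  moreover have "\<forall>B. Q B \<longrightarrow> card B < Suc s" by (simp add: Q_def)
  ultimately obtain B where B: "Q B" and Bmax: "\<And>B'. Q B' \<Longrightarrow> card B' \<le> card B"
    using ex_has_greatest_nat[of Q "{x}" card] by metis
  have finB: "finite B" using B finW finite_subset unfolding Q_def by blast
  have "card B = s"
  proof (rule ccontr)
    assume "card B \<noteq> s"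
    then have Bs: "card B < s" using B by (simp add: Q_def)
    have closed: "{b, y} \<notin> edges G" if "b \<in> B" "y \<in> W - U - B" for b y
    proof
      assume "{b, y} \<in> edges G"
      then have "Q (insert y B)"
        using B that Bs finB by (auto simp: Q_def intro: cut_connected_insert)
      then show False using Bmax[of "insert y B"] that finB by auto
    qed
    have cardUB: "card (U \<union> B) = card U + card B"
      using UW finB B by (intro card_Un_disjoint) (auto simp: Q_def)
    have "P (U \<union> B)"
      using U B closed cardUB small Bs by (auto simp: P_def Q_def)
    moreover have "0 < card B" using finB B by (auto simp: Q_def card_gt_0_iff)
    ultimately show False using Umax[of "U \<union> B"] cardUB by simp
  qed
  then show ?thesis using B by (auto simp: Q_def)
qed

lemma disjoint_connected_sets:
  assumes fin: "finite (verts G)" and hole: "no_bipartite_hole G s" and s: "0 < s"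
    and T: "finite T" and W: "W \<subseteq> verts G" "(card T + 2) * s \<le> card W"
  shows "\<exists>B. (\<forall>x\<in>T. B x \<subseteq> W \<and> card (B x) = s \<and> cut_connected G (B x)) \<and>
             (\<forall>x\<in>T. \<forall>y\<in>T. x \<noteq> y \<longrightarrow> B x \<inter> B y = {})"
  using T W
proof (induction T arbitrary: W)
  case empty
  then show ?case by simp
next
  case (insert t T)
  have "3 * s \<le> card W" using insert.prems(2) insert.hyps by simp
  then obtain B0 where B0: "B0 \<subseteq> W" "card B0 = s" "cut_connected G B0"
    using connected_set_of_size[OF fin hole s insert.prems(1)] by blast
  have "finite B0" using B0(1) insert.prems(1) by (intro finite_subset[OF _ fin]) simp
  then have "card (W - B0) = card W - s" using B0 by (simp add: card_Diff_subset)
  then have "(card T + 2) * s \<le> card (W - B0)" using insert.prems(2) insert.hyps by simp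
  moreover have "W - B0 \<subseteq> verts G" using insert.prems(1) by auto
  ultimately obtain B where B: "\<forall>x\<in>T. B x \<subseteq> W - B0 \<and> card (B x) = s \<and> cut_connected G (B x)"
      "\<forall>x\<in>T. \<forall>y\<in>T. x \<noteq> y \<longrightarrow> B x \<inter> B y = {}"
    using insert.IH by meson
  have "(\<forall>x\<in>insert t T. (B(t := B0)) x \<subseteq> W \<and> card ((B(t := B0)) x) = s \<and> cut_connected G ((B(t := B0)) x)) \<and>
        (\<forall>x\<in>insert t T. \<forall>y\<in>insert t T. x \<noteq> y \<longrightarrow> (B(t := B0)) x \<inter> (B(t := B0)) y = {})"
    using B B0 insert.hyps by auto
  then show ?case by (intro exI[of _ "B(t := B0)"])
qed

lemma simple_graph_delete_verts:
  assumes "simple_graph G"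
  shows "simple_graph (delete_verts G X)"
  using assms by (auto simp: simple_graph_def delete_verts_def)

lemma minor_after_deletion:
  assumes G: "simple_graph G" and H: "simple_graph H"
    and hole: "no_bipartite_hole G s" and s: "0 < s"
    and X: "(card (verts H) + 2) * s \<le> card (verts G - X)"
  shows "is_minor H (delete_verts G X)"
proof -
  have fin: "finite (verts G)" "finite (verts H)" using G H by (auto simp: simple_graph_def)
  obtain B where B: "\<forall>x\<in>verts H. B x \<subseteq> verts G - X \<and> card (B x) = s \<and> cut_connected G (B x)"
      "\<forall>x\<in>verts H. \<forall>y\<in>verts H. x \<noteq> y \<longrightarrow> B x \<inter> B y = {}"
    using disjoint_connected_sets[OF fin(1) hole s fin(2), of "verts G - X"] X by auto
  have survive: "{a, b} \<in> edges (delete_verts G X)"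
    if "{a, b} \<in> edges G" "a \<notin> X" "b \<notin> X" for a b
    using that by (simp add: delete_verts_def)
  show ?thesis
  proof (rule is_minor_of_branch_sets[where B = B])
    show "simple_graph (delete_verts G X)" "simple_graph H"
      using G H simple_graph_delete_verts by auto
    show "B x \<inter> B y = {}" if "x \<in> verts H" "y \<in> verts H" "x \<noteq> y" for x y
      using B that by blast
    show "B x \<subseteq> verts (delete_verts G X) \<and> B x \<noteq> {} \<and> cut_connected (delete_verts G X) (B x)"
      if x: "x \<in> verts H" for x
    proof (intro conjI)
      show "B x \<subseteq> verts (delete_verts G X)" "B x \<noteq> {}"
        using B x s by (auto simp: delete_verts_def)
      have "cut_connected G (B x)" "B x \<inter> X = {}" using B x by auto
      then show "cut_connected (delete_verts G X) (B x)"
        by (elim cut_connected_mono) (auto intro: survive)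
    qed
    show "\<exists>a\<in>B x. \<exists>b\<in>B y. {a, b} \<in> edges (delete_verts G X)" if xy: "{x, y} \<in> edges H" for x y
    proof -
      have "\<forall>e\<in>edges H. e \<subseteq> verts H \<and> card e = 2" using H by (simp add: simple_graph_def)
      from bspec[OF this xy] have V: "x \<in> verts H" "y \<in> verts H" "x \<noteq> y" by auto
      then have "B x \<subseteq> verts G" "B y \<subseteq> verts G" "B x \<inter> B y = {}" "card (B x) = s" "card (B y) = s"
        using B by auto
      then have "\<exists>a\<in>B x. \<exists>b\<in>B y. {a, b} \<in> edges G"
        using hole unfolding no_bipartite_hole_def by simp
      then obtain a b where ab: "a \<in> B x" "b \<in> B y" "{a, b} \<in> edges G" by blast
      then have "{a, b} \<in> edges (delete_verts G X)" using B V by (intro survive) auto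
      then show ?thesis using ab by blast
    qed
  qed
qed

section \<open>A graph with few short cycles and no bipartite hole\<close>

definition all_pairs :: "nat \<Rightarrow> nat set set" where
  "all_pairs n = {e. e \<subseteq> {..<n} \<and> card e = 2}"

text \<open>
  The random graph with edge probability \<^term>\<open>1 / q\<close> is modelled by counting: every pair
  receives one of \<^term>\<open>q\<close> equally likely colours, and the pairs of colour 0 are the edges.
\<close>
definition colourings :: "nat \<Rightarrow> nat \<Rightarrow> (nat set \<Rightarrow> nat) set" where
  "colourings n q = all_pairs n \<rightarrow>\<^sub>E {..<q}"

definition zero_graph :: "nat \<Rightarrow> (nat set \<Rightarrow> nat) \<Rightarrow> nat ugraph" where
  "zero_graph n g = \<lparr> verts = {..<n}, edges = {e \<in> all_pairs n. g e = 0} \<rparr>"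

lemma finite_all_pairs: "finite (all_pairs n)"
  unfolding all_pairs_def by simp

lemma finite_colourings: "finite (colourings n q)"
  unfolding colourings_def by (intro finite_PiE finite_all_pairs) auto

lemma simple_graph_zero_graph: "simple_graph (zero_graph n g)"
  by (auto simp: simple_graph_def zero_graph_def all_pairs_def)

lemma card_colourings_restricted:
  assumes C: "C \<subseteq> all_pairs n" and A: "A \<subseteq> {..<q}"
  shows "card {g \<in> colourings n q. \<forall>e\<in>C. g e \<in> A} * q ^ card C = card A ^ card C * card (colourings n q)"
proof -
  have finC: "finite C" using C finite_all_pairs finite_subset by blast
  have "{g \<in> colourings n q. \<forall>e\<in>C. g e \<in> A} = PiE (all_pairs n) (\<lambda>e. if e \<in> C then A else {..<q})"
  proof (intro set_eqI iffI)
    fix g assume "g \<in> {g \<in> colourings n q. \<forall>e\<in>C. g e \<in> A}"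
    then show "g \<in> PiE (all_pairs n) (\<lambda>e. if e \<in> C then A else {..<q})"
      by (simp add: colourings_def PiE_iff)
  next
    fix g assume g: "g \<in> PiE (all_pairs n) (\<lambda>e. if e \<in> C then A else {..<q})"
    have "g e \<in> {..<q} \<and> (e \<in> C \<longrightarrow> g e \<in> A)" if "e \<in> all_pairs n" for e
      using PiE_mem[OF g that] A by (cases "e \<in> C") auto
    then show "g \<in> {g \<in> colourings n q. \<forall>e\<in>C. g e \<in> A}"
      using g C unfolding colourings_def PiE_iff by blast
  qed
  then have "card {g \<in> colourings n q. \<forall>e\<in>C. g e \<in> A} = (\<Prod>e\<in>all_pairs n. if e \<in> C then card A else q)"
    by (simp add: card_PiE finite_all_pairs if_distrib cong: if_cong)
  also have "\<dots> = (\<Prod>e\<in>C. card A) * (\<Prod>e\<in>all_pairs n - C. q)"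
    using prod.subset_diff[OF C finite_all_pairs, of "\<lambda>e. if e \<in> C then card A else q"]
    by (simp add: mult.commute)
  finally have *: "card {g \<in> colourings n q. \<forall>e\<in>C. g e \<in> A} = card A ^ card C * q ^ card (all_pairs n - C)"
    by simp
  have "card (colourings n q) = q ^ card (all_pairs n)"
    unfolding colourings_def by (simp add: card_PiE finite_all_pairs)
  also have "card (all_pairs n) = card C + card (all_pairs n - C)"
    using C finC finite_all_pairs by (simp add: card_Diff_subset card_mono)
  finally have "card (colourings n q) = q ^ card C * q ^ card (all_pairs n - C)"
    by (simp only: power_add)
  with * show ?thesis by simp
qed

lemma doubleton_mod_inj:
  fixes i j m :: nat
  assumes "distinct vs" "length vs = m" "3 \<le> m" "i < m" "j < m"
    and "{vs ! i, vs ! (Suc i mod m)} = {vs ! j, vs ! (Suc j mod m)}"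
  shows "i = j"
proof (rule ccontr)
  assume ne: "i \<noteq> j"
  have lt: "Suc i mod m < m" "Suc j mod m < m" using assms by auto
  have "vs ! i = vs ! (Suc j mod m)" "vs ! j = vs ! (Suc i mod m)"
    using assms ne by (auto simp: doubleton_eq_iff nth_eq_iff_index_eq)
  then have "i = Suc j mod m" "j = Suc i mod m"
    using assms lt by (simp_all add: nth_eq_iff_index_eq)
  moreover have "Suc x mod m = (if Suc x = m then 0 else Suc x)" if "x < m" for x
    using that by auto
  ultimately have "Suc j = m \<and> i = 0 \<or> i = Suc j" "Suc i = m \<and> j = 0 \<or> j = Suc i"
    using assms(4,5) by metis+
  then show False using assms(3) by presburger
qed

lemma card_colourings_with_cycle:
  assumes vs: "set vs \<subseteq> {..<n}" "distinct vs" "3 \<le> length vs" and q: "0 < q"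
  shows "card {g \<in> colourings n q. is_cycle (zero_graph n g) vs} * q ^ length vs = card (colourings n q)"
proof -
  let ?m = "length vs"
  define ed where "ed i = {vs ! i, vs ! (Suc i mod ?m)}" for i
  define C where "C = ed ` {..<?m}"
  have "inj_on ed {..<?m}"
    unfolding inj_on_def ed_def using doubleton_mod_inj[OF vs(2) refl vs(3)] by blast
  then have cardC: "card C = ?m" by (simp add: C_def card_image)
  have "ed i \<in> all_pairs n" if i: "i < ?m" for i
  proof -
    have lt: "Suc i mod ?m < ?m" using i by (intro mod_less_divisor) auto
    have "Suc i mod ?m \<noteq> i" using i vs(3) by (cases "Suc i = ?m") auto
    then have "vs ! i \<noteq> vs ! (Suc i mod ?m)" using vs i lt by (simp add: nth_eq_iff_index_eq)
    moreover have "vs ! i \<in> set vs" "vs ! (Suc i mod ?m) \<in> set vs" using i lt nth_mem by blast+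
    ultimately show ?thesis using vs(1) by (auto simp: ed_def all_pairs_def)
  qed
  then have C: "C \<subseteq> all_pairs n" by (auto simp: C_def)
  have "{g \<in> colourings n q. is_cycle (zero_graph n g) vs} = {g \<in> colourings n q. \<forall>e\<in>C. g e \<in> {0}}"
    using vs C by (auto simp: is_cycle_def zero_graph_def C_def ed_def)
  then show ?thesis using card_colourings_restricted[OF C, of "{0}" q] q cardC by simp
qed

lemma cycles_of_zero_graph_subset:
  "{vs. is_cycle (zero_graph n g) vs \<and> length vs \<le> l} \<subseteq> {vs. set vs \<subseteq> {..<n} \<and> length vs \<le> l}"
  by (auto simp: is_cycle_def zero_graph_def)

lemma card_filter_eq_sum:
  assumes "finite A"
  shows "card {x \<in> A. P x} = (\<Sum>x\<in>A. of_bool (P x))"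
  using assms by (simp add: Int_def)

text \<open>
  A cyclic sequence of \<^term>\<open>i\<close> vertices can be placed in at most \<^term>\<open>n ^ i\<close> ways, and each
  placement is a cycle with probability \<^term>\<open>1 / q ^ i\<close>; with average degree about
  \<^term>\<open>d = n / q\<close> this makes at most \<^term>\<open>d ^ i\<close> expected cycles of length \<^term>\<open>i\<close>.
\<close>
lemma total_short_cycles:
  assumes q: "0 < q" and d: "1 \<le> d" and n: "n = d * q"
  shows "(\<Sum>g\<in>colourings n q. card {vs. is_cycle (zero_graph n g) vs \<and> length vs \<le> l})
           \<le> l * d ^ l * card (colourings n q)"
proof -
  let ?Om = "colourings n q"
  define L where "L i = {vs. set vs \<subseteq> {..<n} \<and> length vs = i \<and> distinct vs}" for i
  have finL: "finite (L i)" for i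
    by (rule finite_subset[OF _ finite_lists_length_eq[of "{..<n}" i]]) (auto simp: L_def)
  have cardL: "card (L i) \<le> n ^ i" for i
  proof -
    have "card (L i) \<le> card {vs. set vs \<subseteq> {..<n} \<and> length vs = i}"
      by (rule card_mono) (auto simp: L_def finite_lists_length_eq)
    also have "\<dots> = n ^ i" using card_lists_length_eq[of "{..<n}" i] by simp
    finally show ?thesis .
  qed
  have per_length: "(\<Sum>vs\<in>L i. card {g \<in> ?Om. is_cycle (zero_graph n g) vs}) \<le> d ^ l * card ?Om"
    if i: "i \<in> {3..l}" for i
  proof -
    have "(\<Sum>vs\<in>L i. card {g \<in> ?Om. is_cycle (zero_graph n g) vs}) * q ^ i
        = (\<Sum>vs\<in>L i. card {g \<in> ?Om. is_cycle (zero_graph n g) vs} * q ^ i)"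
      by (rule sum_distrib_right)
    also have "\<dots> = (\<Sum>vs\<in>L i. card ?Om)"
      using i q by (intro sum.cong refl) (auto simp: L_def card_colourings_with_cycle)
    also have "\<dots> \<le> n ^ i * card ?Om" using cardL by simp
    also have "\<dots> = d ^ i * card ?Om * q ^ i" by (simp add: n power_mult_distrib)
    finally have "(\<Sum>vs\<in>L i. card {g \<in> ?Om. is_cycle (zero_graph n g) vs}) \<le> d ^ i * card ?Om"
      using q by simp
    also have "\<dots> \<le> d ^ l * card ?Om"
      using i d by (intro mult_right_mono power_increasing) auto
    finally show ?thesis .
  qed
  have "(\<Sum>g\<in>?Om. card {vs. is_cycle (zero_graph n g) vs \<and> length vs \<le> l})
      = (\<Sum>g\<in>?Om. card {vs \<in> (\<Union>i\<in>{3..l}. L i). is_cycle (zero_graph n g) vs})"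
    by (intro sum.cong refl arg_cong[where f = card]) (auto simp: is_cycle_def zero_graph_def L_def)
  also have "\<dots> = (\<Sum>g\<in>?Om. \<Sum>vs\<in>(\<Union>i\<in>{3..l}. L i). of_bool (is_cycle (zero_graph n g) vs))"
    by (intro sum.cong refl card_filter_eq_sum) (use finL in blast)
  also have "\<dots> = (\<Sum>vs\<in>(\<Union>i\<in>{3..l}. L i). \<Sum>g\<in>?Om. of_bool (is_cycle (zero_graph n g) vs))"
    by (rule sum.swap)
  also have "\<dots> = (\<Sum>vs\<in>(\<Union>i\<in>{3..l}. L i). card {g \<in> ?Om. is_cycle (zero_graph n g) vs})"
    by (intro sum.cong refl card_filter_eq_sum[symmetric] finite_colourings)
  also have "\<dots> = (\<Sum>i\<in>{3..l}. \<Sum>vs\<in>L i. card {g \<in> ?Om. is_cycle (zero_graph n g) vs})"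
    using finL by (intro sum.UNION_disjoint) (auto simp: L_def)
  also have "\<dots> \<le> (\<Sum>i\<in>{3..l}. d ^ l * card ?Om)" by (intro sum_mono per_length)
  also have "\<dots> \<le> l * d ^ l * card ?Om" by simp
  finally show ?thesis .
qed

lemma card_colourings_with_hole_at:
  assumes q: "0 < q" and AB: "A \<subseteq> {..<n}" "B \<subseteq> {..<n}" "A \<inter> B = {}" "card A = s" "card B = s"
  shows "real (card {g \<in> colourings n q. \<forall>a\<in>A. \<forall>b\<in>B. {a, b} \<notin> edges (zero_graph n g)})
           \<le> exp (- (real s ^ 2 / real q)) * real (card (colourings n q))"
proof -
  define C where "C = (\<lambda>(a, b). {a, b}) ` (A \<times> B)"
  have "inj_on (\<lambda>(a, b). {a, b}) (A \<times> B)"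
    using AB(3) by (auto simp: inj_on_def doubleton_eq_iff)
  then have cardC: "card C = s * s"
    using AB by (simp add: C_def card_image card_cartesian_product)
  have C: "C \<subseteq> all_pairs n"
    using AB by (fastforce simp: C_def all_pairs_def card_2_iff)
  have "{g \<in> colourings n q. \<forall>a\<in>A. \<forall>b\<in>B. {a, b} \<notin> edges (zero_graph n g)}
      = {g \<in> colourings n q. \<forall>e\<in>C. g e \<in> {1..<q}}" (is "?X = ?Y")
  proof (intro Collect_cong conj_cong refl)
    fix g assume g: "g \<in> colourings n q"
    have "(\<forall>a\<in>A. \<forall>b\<in>B. {a, b} \<notin> edges (zero_graph n g)) \<longleftrightarrow> (\<forall>e\<in>C. e \<notin> edges (zero_graph n g))"
      by (auto simp: C_def)
    also have "\<dots> \<longleftrightarrow> (\<forall>e\<in>C. g e \<in> {1..<q})"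
    proof (intro ball_cong refl)
      fix e assume "e \<in> C"
      then have "e \<in> all_pairs n" using C by auto
      moreover from this have "g e < q" using g by (auto simp: colourings_def)
      ultimately show "e \<notin> edges (zero_graph n g) \<longleftrightarrow> g e \<in> {1..<q}"
        by (auto simp: zero_graph_def)
    qed
    finally show "(\<forall>a\<in>A. \<forall>b\<in>B. {a, b} \<notin> edges (zero_graph n g)) \<longleftrightarrow> (\<forall>e\<in>C. g e \<in> {1..<q})" .
  qed
  moreover have "{1..<q} \<subseteq> {..<q}" by auto
  ultimately have "card ?X * q ^ (s * s) = (q - 1) ^ (s * s) * card (colourings n q)"
    using card_colourings_restricted[OF C, of "{1..<q}" q] cardC by (simp only: card_atLeastLessThan)
  then have "real (card ?X * q ^ (s * s)) = real ((q - 1) ^ (s * s) * card (colourings n q))"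
    by (rule arg_cong)
  then have "real (card ?X) = (real (q - 1) / real q) ^ (s * s) * real (card (colourings n q))"
    using q by (simp add: power_divide field_simps)
  also have "\<dots> \<le> exp (- (real s ^ 2 / real q)) * real (card (colourings n q))"
  proof (rule mult_right_mono)
    have "real (q - 1) / real q = 1 + - (1 / real q)" using q by (simp add: of_nat_diff field_simps)
    also have "\<dots> \<le> exp (- (1 / real q))" by (rule exp_ge_add_one_self)
    finally have "(real (q - 1) / real q) ^ (s * s) \<le> exp (- (1 / real q)) ^ (s * s)"
      by (intro power_mono) auto
    also have "\<dots> = exp (- (real s ^ 2 / real q))"
      by (simp add: power2_eq_square flip: exp_of_nat_mult)
    finally show "(real (q - 1) / real q) ^ (s * s) \<le> exp (- (real s ^ 2 / real q))" .
  qed simp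
  finally show ?thesis .
qed

text \<open>
  There are at most \<^term>\<open>4 ^ n\<close> candidates for a hole, and each one occurs with probability at
  most \<^term>\<open>exp (- (s\<^sup>2 / q))\<close>. The sizes \<^term>\<open>s = 3 * a * q\<close> and
  \<^term>\<open>n = a * s\<close> are chosen so that the exponent \<^term>\<open>9 * a\<^sup>2 * q\<close> beats
  \<^term>\<open>ln 4 * n\<close>, while \<^term>\<open>s\<close> is still a small fraction of \<^term>\<open>n\<close>.
\<close>
lemma card_colourings_with_hole:
  assumes q: "0 < q" and a: "0 < a" and n: "n = 3 * a ^ 2 * q" and s: "s = 3 * a * q"
  shows "2 * card {g \<in> colourings n q. \<not> no_bipartite_hole (zero_graph n g) s} \<le> card (colourings n q)"
proof -
  let ?Om = "colourings n q"
  define I where "I = {(A, B). A \<subseteq> {..<n} \<and> B \<subseteq> {..<n} \<and> A \<inter> B = {} \<and> card A = s \<and> card B = s}"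
  define bad where "bad A B = {g \<in> ?Om. \<forall>a\<in>A. \<forall>b\<in>B. {a, b} \<notin> edges (zero_graph n g)}" for A B
  have IP: "I \<subseteq> Pow {..<n} \<times> Pow {..<n}" by (auto simp: I_def)
  then have finI: "finite I" by (rule finite_subset) simp
  have cardI: "card I \<le> 4 ^ n"
  proof -
    have "card I \<le> card (Pow {..<n} \<times> Pow {..<n})" using IP by (intro card_mono) auto
    also have "\<dots> = 4 ^ n" by (simp add: card_cartesian_product card_Pow flip: power_mult_distrib)
    finally show ?thesis .
  qed
  have "{g \<in> ?Om. \<not> no_bipartite_hole (zero_graph n g) s} \<subseteq> (\<Union>(A, B)\<in>I. bad A B)"
    by (fastforce simp: no_bipartite_hole_def I_def bad_def zero_graph_def)
  then have "card {g \<in> ?Om. \<not> no_bipartite_hole (zero_graph n g) s} \<le> card (\<Union>(A, B)\<in>I. bad A B)"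
    using finI finite_colourings by (intro card_mono) (auto simp: bad_def)
  also have "\<dots> \<le> (\<Sum>(A, B)\<in>I. card (bad A B))"
    using card_UN_le[OF finI, of "\<lambda>(A, B). bad A B"] by (simp add: case_prod_beta)
  finally have "real (card {g \<in> ?Om. \<not> no_bipartite_hole (zero_graph n g) s})
      \<le> real (\<Sum>(A, B)\<in>I. card (bad A B))" by (rule of_nat_mono)
  also have "\<dots> = (\<Sum>(A, B)\<in>I. real (card (bad A B)))" by (simp add: case_prod_beta)
  also have "\<dots> \<le> (\<Sum>(A, B)\<in>I. exp (- (real s ^ 2 / real q)) * real (card ?Om))"
    using card_colourings_with_hole_at[OF q] by (intro sum_mono) (auto simp: I_def bad_def)
  also have "\<dots> = real (card I) * (exp (- (real s ^ 2 / real q)) * real (card ?Om))"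
    by (simp add: case_prod_beta)
  also have "\<dots> \<le> 4 ^ n * (exp (- (real s ^ 2 / real q)) * real (card ?Om))"
    using cardI by (intro mult_right_mono) (auto simp flip: of_nat_le_iff)
  also have "\<dots> = (4 ^ n * exp (- (real s ^ 2 / real q))) * real (card ?Om)" by simp
  also have "\<dots> \<le> 1 / 2 * real (card ?Om)"
  proof (rule mult_right_mono)
    have e1: "(2::real) \<le> exp 1" using exp_ge_add_one_self[of 1] by simp
    then have "(2::real) ^ 2 \<le> exp 1 ^ 2" by (intro power_mono) auto
    then have "(4::real) \<le> exp 2" by (simp flip: exp_of_nat_mult)
    then have "(4::real) ^ n \<le> exp 2 ^ n" by (intro power_mono) auto
    also have "\<dots> = exp (2 * real n)" by (simp add: mult.commute flip: exp_of_nat_mult)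
    finally have "4 ^ n * exp (- (real s ^ 2 / real q)) \<le> exp (2 * real n) * exp (- (real s ^ 2 / real q))"
      by (intro mult_right_mono) auto
    also have "\<dots> = exp (- real (3 * a ^ 2 * q))"
      using q by (simp add: n s power2_eq_square field_simps flip: exp_add)
    also have "\<dots> \<le> exp (- 1)"
    proof -
      have "1 \<le> 3 * a ^ 2 * q" using a q by (simp add: Suc_le_eq)
      then have "real 1 \<le> real (3 * a ^ 2 * q)" by (rule of_nat_mono)
      then show ?thesis by (simp only: exp_le_cancel_iff neg_le_iff_le of_nat_1)
    qed
    also have "\<dots> \<le> 1 / 2" using e1 by (simp add: exp_minus field_simps)
    finally show "4 ^ n * exp (- (real s ^ 2 / real q)) \<le> 1 / 2" .
  qed simp
  finally show ?thesis by simp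
qed

text \<open>
  At least half of the colourings leave no hole, so one of them has at most twice the average
  number of short cycles.
\<close>
lemma sparse_hole_free_graph_exists:
  assumes q: "0 < q" and a: "0 < a"
    and d: "d = 3 * a ^ 2" and n: "n = d * q" and s: "s = 3 * a * q"
  shows "\<exists>G :: nat ugraph. simple_graph G \<and> verts G = {..<n} \<and> no_bipartite_hole G s \<and>
           finite {vs. is_cycle G vs \<and> length vs \<le> l} \<and>
           card {vs. is_cycle G vs \<and> length vs \<le> l} \<le> 2 * l * d ^ l"
proof -
  let ?Om = "colourings n q"
  define sc where "sc g = card {vs. is_cycle (zero_graph n g) vs \<and> length vs \<le> l}" for g
  define good where "good = {g \<in> ?Om. no_bipartite_hole (zero_graph n g) s}"
  have fin: "finite ?Om" by (rule finite_colourings)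
  have "card ?Om = card good + card {g \<in> ?Om. \<not> no_bipartite_hole (zero_graph n g) s}"
    unfolding good_def using fin by (subst card_Un_disjoint[symmetric]) (auto intro: arg_cong[where f = card])
  then have half: "card ?Om \<le> 2 * card good"
    using card_colourings_with_hole[OF q a _ s, of n] n d by simp
  have "\<exists>g\<in>good. sc g \<le> 2 * l * d ^ l"
  proof (rule ccontr)
    assume "\<not> ?thesis"
    then have big: "2 * l * d ^ l + 1 \<le> sc g" if "g \<in> good" for g using that by force
    have pos: "0 < card ?Om"
      using q fin by (simp add: colourings_def card_PiE finite_all_pairs)
    have "(2 * l * d ^ l + 1) * card ?Om \<le> 2 * (card good * (2 * l * d ^ l + 1))"
      using mult_right_mono[OF half, of "2 * l * d ^ l + 1"] by (simp add: algebra_simps)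
    also have "card good * (2 * l * d ^ l + 1) \<le> (\<Sum>g\<in>good. sc g)"
      using sum_mono[of good "\<lambda>_. 2 * l * d ^ l + 1" sc] big by simp
    also have "\<dots> \<le> (\<Sum>g\<in>?Om. sc g)"
      using fin by (intro sum_mono2) (auto simp: good_def)
    also have "\<dots> \<le> l * d ^ l * card ?Om"
      unfolding sc_def using a by (intro total_short_cycles[OF q _ n]) (simp add: d)
    finally show False using pos by (simp add: algebra_simps)
  qed
  then obtain g where g: "g \<in> good" "sc g \<le> 2 * l * d ^ l" by blast
  have "finite {vs. is_cycle (zero_graph n g) vs \<and> length vs \<le> l}"
    by (rule finite_subset[OF cycles_of_zero_graph_subset]) (simp add: finite_lists_length_le)
  moreover have "verts (zero_graph n g) = {..<n}" by (simp add: zero_graph_def)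
  ultimately show ?thesis
    using g by (intro exI[of _ "zero_graph n g"]) (auto simp: good_def sc_def simple_graph_zero_graph)
qed

section \<open>Packing and covering numbers\<close>

lemma finite_subgraphs:
  assumes "simple_graph G"
  shows "finite {K. subgraph K G}"
proof (rule finite_subset)
  have fin: "finite (verts G)" using assms by (simp add: simple_graph_def)
  show "{K. subgraph K G} \<subseteq> (\<lambda>(V, E). \<lparr> verts = V, edges = E \<rparr>) ` (Pow (verts G) \<times> Pow (Pow (verts G)))"
  proof
    fix K assume "K \<in> {K. subgraph K G}"
    then have "verts K \<in> Pow (verts G)" "edges K \<in> Pow (Pow (verts G))"
      by (auto simp: subgraph_def simple_graph_def)
    moreover have "K = (\<lambda>(V, E). \<lparr> verts = V, edges = E \<rparr>) (verts K, edges K)" by simp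
    ultimately show "K \<in> (\<lambda>(V, E). \<lparr> verts = V, edges = E \<rparr>) ` (Pow (verts G) \<times> Pow (Pow (verts G)))"
      by blast
  qed
  show "finite ((\<lambda>(V, E). \<lparr> verts = V, edges = E \<rparr>) ` (Pow (verts G) \<times> Pow (Pow (verts G))))"
    using fin by simp
qed

lemma finite_packing:
  assumes "simple_graph G" "packing F G P"
  shows "finite P"
  by (rule finite_subset[OF _ finite_subgraphs[OF assms(1)]])
    (use assms(2) in \<open>auto simp: packing_def\<close>)

lemma finite_packing_sizes:
  assumes "simple_graph G"
  shows "finite {card P | P. packing F G P}"
proof -
  have "{card P | P. packing F G P} \<subseteq> card ` Pow {K. subgraph K G}"
    by (auto simp: packing_def)
  then show ?thesis using finite_subgraphs[OF assms] by (meson finite_Pow_iff finite_imageI finite_subset)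
qed

lemma card_packing_le:
  assumes "simple_graph G" "packing F G P"
  shows "card P \<le> packing_number F G"
  unfolding packing_number_def using assms finite_packing_sizes by (intro Max_ge) auto

lemma packing_number_le:
  assumes "simple_graph G" "\<And>P. packing F G P \<Longrightarrow> card P \<le> m"
  shows "packing_number F G \<le> m"
proof -
  have "packing F G {}" by (simp add: packing_def)
  then show ?thesis
    unfolding packing_number_def using finite_packing_sizes[OF assms(1)] assms(2)
    by (intro Max.boundedI) auto
qed

lemma packing_disjoint:
  assumes "packing F G P" "K \<in> P" "L \<in> P" "x \<in> verts K" "x \<in> verts L"
  shows "K = L"
  using assms unfolding packing_def by blast

text \<open>
  Members of a packing with more than \<^term>\<open>l\<close> vertices are few because they are disjoint, and
  the others are no more numerous than the short cycles because each of them owns one.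
\<close>
lemma packing_le_short_cycles:
  fixes G :: "'b ugraph"
  assumes G: "simple_graph G" and P: "packing F G P"
    and cyc: "\<And>K. K \<in> P \<Longrightarrow> \<exists>vs. is_cycle K vs"
    and fin: "finite {vs. is_cycle G vs \<and> length vs \<le> l}"
  shows "card P * l \<le> card {vs. is_cycle G vs \<and> length vs \<le> l} * l + card (verts G)"
proof -
  have finV: "finite (verts G)" using G by (simp add: simple_graph_def)
  have finP: "finite P" using finite_packing[OF G P] .
  have sub: "subgraph K G" if "K \<in> P" for K using P that by (simp add: packing_def)
  have KV: "verts K \<subseteq> verts G" "finite (verts K)" if "K \<in> P" for K
    using sub[OF that] by (auto simp: subgraph_def simple_graph_def)
  define S where "S = {K \<in> P. card (verts K) \<le> l}"
  define c where "c K = (SOME vs. is_cycle K vs)" for K :: "'b ugraph"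
  have c: "is_cycle K (c K)" if "K \<in> P" for K
    using cyc[OF that] unfolding c_def by (rule someI_ex)
  have "card S \<le> card {vs. is_cycle G vs \<and> length vs \<le> l}"
  proof (rule card_inj_on_le[OF _ _ fin])
    show "inj_on c S"
    proof (rule inj_onI)
      fix K L assume KL: "K \<in> S" "L \<in> S" "c K = c L"
      have K: "is_cycle K (c K)" and L: "is_cycle L (c L)"
        using c KL(1,2) unfolding S_def by blast+
      then have "hd (c K) \<in> set (c K)" by (intro hd_in_set) (auto simp: is_cycle_def)
      then have "hd (c K) \<in> verts K" "hd (c K) \<in> verts L" using K L KL by (auto simp: is_cycle_def)
      then show "K = L" using packing_disjoint[OF P] KL by (auto simp: S_def)
    qed
    show "c ` S \<subseteq> {vs. is_cycle G vs \<and> length vs \<le> l}"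
    proof
      fix vs assume "vs \<in> c ` S"
      then obtain K where K: "K \<in> P" "card (verts K) \<le> l" "vs = c K" by (auto simp: S_def)
      have "is_cycle K vs" using c K by simp
      moreover from this have "length vs \<le> card (verts K)"
        using KV(2)[OF K(1)] by (auto simp: is_cycle_def card_mono simp flip: distinct_card)
      ultimately show "vs \<in> {vs. is_cycle G vs \<and> length vs \<le> l}"
        using K is_cycle_subgraph[OF sub] by auto
    qed
  qed
  moreover have "card (P - S) * l \<le> card (verts G)"
  proof -
    have "card (P - S) * l = (\<Sum>K\<in>P - S. l)" by simp
    also have "\<dots> \<le> (\<Sum>K\<in>P - S. card (verts K))" by (intro sum_mono) (auto simp: S_def)
    also have "\<dots> = card (\<Union>K\<in>P - S. verts K)"
      using finP KV packing_disjoint[OF P] by (subst card_UN_disjoint) auto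
    also have "\<dots> \<le> card (verts G)" using KV finV by (intro card_mono) auto
    finally show ?thesis .
  qed
  moreover have "card P = card S + card (P - S)"
    using finP by (subst card_Diff_subset) (auto simp: S_def card_mono)
  ultimately show ?thesis by (simp add: add_mult_distrib add_mono)
qed

lemma covering_number_ge:
  assumes F: "\<And>H. H \<in> F \<Longrightarrow> simple_graph H \<and> \<not> forest H"
    and G: "simple_graph G" and X: "\<And>X. hitting_set F G X \<Longrightarrow> m \<le> card X"
  shows "m \<le> covering_number F G"
proof -
  have fin: "finite (verts G)" using G by (simp add: simple_graph_def)
  have "\<not> has_minor_from F (delete_verts G (verts G))"
  proof
    assume "has_minor_from F (delete_verts G (verts G))"
    then obtain H vs where "H \<in> F" "is_cycle (delete_verts G (verts G)) vs"
      unfolding has_minor_from_def using F cycle_of_minor by blast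
    then show False by (auto simp: is_cycle_def delete_verts_def)
  qed
  then have "hitting_set F G (verts G)" by (simp add: hitting_set_def)
  moreover have "{card X | X. hitting_set F G X} \<subseteq> card ` Pow (verts G)"
    by (auto simp: hitting_set_def)
  then have "finite {card X | X. hitting_set F G X}" using fin by (meson finite_Pow_iff finite_imageI finite_subset)
  ultimately show ?thesis
    unfolding covering_number_def using X by (intro Min.boundedI) auto
qed

lemma hitting_set_subgraph:
  assumes "subgraph K G" "hitting_set F G X"
  shows "hitting_set F K (X \<inter> verts K)"
proof -
  have K: "simple_graph K" "verts K \<subseteq> verts G" "edges K \<subseteq> edges G" and G: "simple_graph G"
    using assms(1) by (auto simp: subgraph_def)
  have "e \<inter> X = {}" if "e \<in> edges K" "e \<inter> (X \<inter> verts K) = {}" for e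
    using K(1) that by (auto simp: simple_graph_def)
  then have sub: "subgraph (delete_verts K (X \<inter> verts K)) (delete_verts G X)"
    using K G simple_graph_delete_verts[of K] simple_graph_delete_verts[of G]
    unfolding subgraph_def by (auto simp: delete_verts_def)
  have "\<not> has_minor_from F (delete_verts K (X \<inter> verts K))"
  proof
    assume "has_minor_from F (delete_verts K (X \<inter> verts K))"
    then have "has_minor_from F (delete_verts G X)"
      unfolding has_minor_from_def using is_minor_subgraph[OF _ sub] by blast
    then show False using assms(2) by (simp add: hitting_set_def)
  qed
  then show ?thesis by (simp add: hitting_set_def)
qed

section \<open>Adjusting the packing number\<close>

text \<open>
  The added vertices are universal, so that sufficiently many of them contain any number of
  disjoint complete graphs of a given order.
\<close>
definition pad :: "nat ugraph \<Rightarrow> nat \<Rightarrow> nat \<Rightarrow> nat ugraph" where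
  "pad G n m = \<lparr> verts = {..<m},
     edges = edges G \<union> {e. e \<subseteq> {..<m} \<and> card e = 2 \<and> \<not> e \<subseteq> {..<n}} \<rparr>"

lemma simple_graph_pad:
  assumes "simple_graph G" "verts G = {..<n}" "n \<le> m"
  shows "simple_graph (pad G n m)"
  using assms by (fastforce simp: simple_graph_def pad_def)

lemma pad_self:
  assumes "verts G = {..<n}"
  shows "pad G n n = G"
proof -
  have no_new: "edges G \<union> {e. e \<subseteq> verts G \<and> card e = 2 \<and> \<not> e \<subseteq> verts G} = edges G" by auto
  show ?thesis unfolding pad_def assms[symmetric] no_new by simp
qed

lemma packing_number_pad_Suc:
  assumes G: "simple_graph G" "verts G = {..<n}" "n \<le> m"
  shows "packing_number F (pad G n (Suc m)) \<le> Suc (packing_number F (pad G n m))"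
proof (rule packing_number_le)
  show S: "simple_graph (pad G n (Suc m))" using G by (intro simple_graph_pad) auto
  have S': "simple_graph (pad G n m)" using G by (intro simple_graph_pad) auto
  fix P assume P: "packing F (pad G n (Suc m)) P"
  define Q where "Q = {K \<in> P. m \<notin> verts K}"
  have "subgraph K (pad G n m)" if K: "K \<in> Q" for K
  proof -
    have sub: "subgraph K (pad G n (Suc m))" using P K by (auto simp: packing_def Q_def)
    then have V: "verts K \<subseteq> {..<m}" using K by (auto simp: subgraph_def pad_def Q_def less_Suc_eq)
    moreover have "e \<in> edges (pad G n m)" if "e \<in> edges K" for e
    proof -
      have "e \<in> edges (pad G n (Suc m))" "e \<subseteq> verts K"
        using sub that by (auto simp: subgraph_def simple_graph_def)
      then show ?thesis using V by (auto simp: pad_def)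
    qed
    ultimately show ?thesis using S' sub by (auto simp: subgraph_def pad_def)
  qed
  then have "packing F (pad G n m) Q" using P by (auto simp: packing_def Q_def)
  then have "card Q \<le> packing_number F (pad G n m)" by (rule card_packing_le[OF S'])
  moreover have "card (P - Q) \<le> 1"
  proof (rule card_le_Suc0_iff_eq[THEN iffD2, folded One_nat_def])
    show "finite (P - Q)" using finite_packing[OF S P] by simp
    show "\<forall>K\<in>P - Q. \<forall>L\<in>P - Q. K = L" using packing_disjoint[OF P] by (auto simp: Q_def)
  qed
  moreover have "card P = card Q + card (P - Q)"
    using finite_packing[OF S P] by (subst card_Diff_subset) (auto simp: Q_def card_mono)
  ultimately show "card P \<le> Suc (packing_number F (pad G n m))" by simp
qed

lemma is_minor_complete_graph:
  fixes H :: "'a ugraph" and V :: "'b set"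
  assumes H: "simple_graph H" and V: "finite V" "card V = card (verts H)"
  shows "is_minor H \<lparr> verts = V, edges = {e. e \<subseteq> V \<and> card e = 2} \<rparr>"
proof -
  have "finite (verts H)" using H by (simp add: simple_graph_def)
  then obtain f where f: "bij_betw f (verts H) V"
    using V finite_same_card_bij by metis
  show ?thesis
  proof (rule is_minor_of_branch_sets[where B = "\<lambda>x. {f x}"])
    show "simple_graph \<lparr> verts = V, edges = {e. e \<subseteq> V \<and> card e = 2} \<rparr>"
      using V by (simp add: simple_graph_def)
    show "\<exists>a\<in>{f x}. \<exists>b\<in>{f y}. {a, b} \<in> edges \<lparr> verts = V, edges = {e. e \<subseteq> V \<and> card e = 2} \<rparr>"
      if xy: "{x, y} \<in> edges H" for x y
    proof -
      have "\<forall>e\<in>edges H. e \<subseteq> verts H \<and> card e = 2" using H by (simp add: simple_graph_def)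
      from bspec[OF this xy] have "x \<in> verts H" "y \<in> verts H" "x \<noteq> y" by auto
      moreover from this have "f x \<noteq> f y" using f by (auto simp: bij_betw_def inj_on_def)
      ultimately show ?thesis using bij_betwE[OF f] by simp
    qed
  qed (use H f in \<open>auto simp: cut_connected_singleton bij_betw_def inj_on_def\<close>)
qed

lemma packing_number_pad_large:
  assumes G: "simple_graph G" "verts G = {..<n}" and H: "H \<in> F" "simple_graph H" "0 < card (verts H)"
  shows "k \<le> packing_number F (pad G n (n + k * card (verts H)))"
proof -
  let ?t = "card (verts H)"
  let ?J = "pad G n (n + k * ?t)"
  define I where "I j = {n + j * ?t..<n + Suc j * ?t}" for j
  define K where "K j = \<lparr> verts = I j, edges = {e. e \<subseteq> I j \<and> card e = 2} \<rparr>" for j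
  have J: "simple_graph ?J" using G by (intro simple_graph_pad) auto
  have disj: "I i \<inter> I j = {}" if "i < j" for i j
  proof -
    have "Suc i * ?t \<le> j * ?t" using that by (intro mult_right_mono) auto
    then show ?thesis by (auto simp: I_def)
  qed
  then have disj': "I i \<inter> I j = {}" if "i \<noteq> j" for i j
    using that by (metis Int_commute linorder_neqE_nat)
  have I: "I j \<noteq> {}" "I j \<inter> {..<n} = {}" for j using H(3) by (auto simp: I_def)
  have sub: "subgraph (K j) ?J" if "j < k" for j
  proof -
    have "Suc j * ?t \<le> k * ?t" using that by (intro mult_right_mono) auto
    then have IJ: "I j \<subseteq> {..<n + k * ?t}" by (auto simp: I_def)
    have new: "\<not> e \<subseteq> {..<n}" if "e \<subseteq> I j" "card e = 2" for e
    proof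
      assume "e \<subseteq> {..<n}"
      then have "e = {}" using that(1) I(2)[of j] by blast
      then show False using that(2) by simp
    qed
    show ?thesis
      unfolding subgraph_def
    proof (intro conjI subsetI)
      show "simple_graph (K j)" by (simp add: simple_graph_def K_def I_def)
      show "x \<in> verts ?J" if "x \<in> verts (K j)" for x
        using that IJ by (simp add: K_def pad_def subset_iff)
      show "e \<in> edges ?J" if "e \<in> edges (K j)" for e
        using that new[of e] subset_trans[OF _ IJ, of e] by (simp add: K_def pad_def)
    qed (rule J)
  qed
  have "is_minor H (K j)" for j
    unfolding K_def using H by (intro is_minor_complete_graph) (auto simp: I_def)
  then have "has_minor_from F (K j)" for j using H(1) by (auto simp: has_minor_from_def)
  moreover have "verts (K i) \<inter> verts (K j) = {}" if "K i \<noteq> K j" for i j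
    using that disj'[of i j] by (cases "i = j") (simp_all add: K_def)
  ultimately have "packing F ?J (K ` {..<k})"
    using sub by (simp add: packing_def)
  then have "card (K ` {..<k}) \<le> packing_number F ?J" by (rule card_packing_le[OF J])
  moreover have "inj_on K {..<k}"
  proof (rule inj_onI)
    fix i j assume "K i = K j"
    then have "I i = I j" by (simp add: K_def)
    then show "i = j" using disj'[of i j] I(1)[of i] by (cases "i = j") simp_all
  qed
  ultimately show ?thesis by (simp add: card_image)
qed

text \<open>
  A new vertex lies in at most one member of a packing, so the packing number grows by at most
  one when a vertex is added. Enough universal vertices push it beyond any bound, hence every
  value in between is attained.
\<close>
lemma exact_packing_number:
  fixes G :: "nat ugraph"
  assumes G: "simple_graph G" "verts G = {..<n}" and H: "H \<in> F" "simple_graph H" "0 < card (verts H)"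
    and k: "packing_number F G \<le> k"
  shows "\<exists>J. simple_graph J \<and> subgraph G J \<and> packing_number F J = k"
proof -
  define f where "f i = packing_number F (pad G n (n + i))" for i
  have step: "f (Suc i) \<le> Suc (f i)" for i
    unfolding f_def using packing_number_pad_Suc[OF G, of "n + i" F] by simp
  have f0: "f 0 \<le> k" using k pad_self[OF G(2)] by (simp add: f_def)
  have ex: "k \<le> f (k * card (verts H))"
    unfolding f_def by (rule packing_number_pad_large[where n = n]) (use G H in auto)
  define i where "i = (LEAST i. k \<le> f i)"
  have i: "k \<le> f i" unfolding i_def using ex by (rule LeastI)
  have "f i \<le> k"
  proof (cases i)
    case 0
    then show ?thesis using f0 by simp
  next
    case (Suc j)
    then have "\<not> k \<le> f j" unfolding i_def by (intro not_less_Least) simp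
    then show ?thesis using step[of j] Suc by simp
  qed
  moreover have "simple_graph (pad G n (n + i))" using G by (intro simple_graph_pad) auto
  moreover from this have "subgraph G (pad G n (n + i))"
    using G by (auto simp: subgraph_def pad_def)
  ultimately show ?thesis using i unfolding f_def by (metis antisym)
qed

section \<open>The lower bound\<close>

lemma four_mult_le_power:
  fixes d l :: nat
  assumes "4 \<le> d"
  shows "4 * l \<le> d ^ l"
proof (cases l)
  case (Suc m)
  have "Suc m \<le> 2 ^ m" by (rule Suc_leI) (rule less_exp)
  also have "\<dots> \<le> d ^ m" using assms by (intro power_mono) auto
  finally have "4 * Suc m \<le> d * d ^ m" using assms by (intro mult_le_mono)
  then show ?thesis using Suc by simp
qed simp

text \<open>
  The bound \<^term>\<open>d ^ (2 * l) \<le> k\<close> keeps the number \<^term>\<open>2 * l * d ^ l\<close> of short cycles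
  at most \<^term>\<open>k / 2\<close>, and the order \<^term>\<open>n\<close> is chosen close to
  \<^term>\<open>k * l / 2\<close>, so that at most \<^term>\<open>k / 2\<close> disjoint subgraphs with more than \<^term>\<open>l\<close>
  vertices fit.
\<close>
lemma packing_covering_gap:
  fixes H :: "'a ugraph"
  assumes F: "\<And>H. H \<in> F \<Longrightarrow> simple_graph H \<and> \<not> forest H" and H: "H \<in> F"
    and d: "d = 3 * (2 * (card (verts H) + 2)) ^ 2"
    and l: "1 \<le> l" "d ^ (2 * l) \<le> k" and k: "4 * d \<le> k"
  shows "\<exists>G :: nat ugraph. simple_graph G \<and> packing_number F G = k \<and> k * l \<le> 8 * covering_number F G"
proof -
  let ?t = "card (verts H)"
  define a where "a = 2 * (?t + 2)"
  define q where "q = k * l div (2 * d)"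
  define n where "n = d * q"
  define s where "s = 3 * a * q"
  have Hs: "simple_graph H" using F H by simp
  have "\<exists>vs. is_cycle H vs" using F[OF H] by (auto simp: forest_def)
  then have tpos: "0 < ?t"
    using Hs by (auto simp: is_cycle_def simple_graph_def card_gt_0_iff)
  have d': "d = 3 * a ^ 2" by (simp add: d a_def)
  have apos: "0 < a" by (simp add: a_def)
  have d4: "4 \<le> d"
  proof -
    have "2 ^ 2 \<le> a ^ 2" by (rule power_mono) (simp_all add: a_def)
    then show ?thesis by (simp add: d')
  qed
  have kl: "4 * d \<le> k * l" using k l(1) by (metis mult.right_neutral mult_le_mono order.trans order_refl)
  have n_le: "2 * n \<le> k * l"
    unfolding n_def q_def using times_div_less_eq_dividend[of "2 * d" "k * l"] by (simp add: mult.assoc)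
  have n_ge: "k * l \<le> 4 * n"
  proof -
    have "k * l < 2 * d * (k * l div (2 * d)) + 2 * d"
      using dividend_less_times_div[of "2 * d" "k * l"] d4 by simp
    then show ?thesis using kl unfolding n_def q_def by (simp add: mult.assoc)
  qed
  have qpos: "0 < q"
    using n_ge kl d4 by (cases q) (auto simp: n_def)
  obtain G :: "nat ugraph" where G: "simple_graph G" "verts G = {..<n}" "no_bipartite_hole G s"
      and fin: "finite {vs. is_cycle G vs \<and> length vs \<le> l}"
      and few: "card {vs. is_cycle G vs \<and> length vs \<le> l} \<le> 2 * l * d ^ l"
    using sparse_hole_free_graph_exists[OF qpos apos d' n_def s_def, of l] by blast
  have spos: "0 < s" using qpos apos by (simp add: s_def)
  have "n = a * s" by (simp add: n_def d' s_def power2_eq_square)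
  then have ns: "n = 2 * ((?t + 2) * s)" by (simp only: a_def mult.assoc)
  have "packing_number F G \<le> k"
  proof (rule packing_number_le[OF G(1)])
    fix P assume P: "packing F G P"
    have cyc: "\<exists>vs. is_cycle K vs" if "K \<in> P" for K
      using P that F cycle_of_minor unfolding packing_def has_minor_from_def by blast
    let ?c = "card {vs. is_cycle G vs \<and> length vs \<le> l}"
    have "4 * l * d ^ l \<le> d ^ l * d ^ l" using four_mult_le_power[OF d4, of l] by simp
    also have "\<dots> = d ^ (2 * l)" by (simp add: mult_2 power_add)
    finally have "2 * ?c \<le> k" using few l(2) by simp
    then have "2 * (?c * l) \<le> k * l" using mult_le_mono1[of "2 * ?c" k l] by (simp only: mult.assoc)
    moreover have "card P * l \<le> ?c * l + n"
      using packing_le_short_cycles[OF G(1) P cyc fin] G(2) by simp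
    ultimately have "card P * l \<le> k * l" using n_le by linarith
    then show "card P \<le> k" using l(1) by simp
  qed
  then obtain J where J: "simple_graph J" "subgraph G J" "packing_number F J = k"
    using exact_packing_number[OF G(1,2) H Hs tpos] by blast
  have "(?t + 2) * s \<le> covering_number F J"
  proof (rule covering_number_ge[OF F J(1)])
    fix X assume "hitting_set F J X"
    then have hit: "hitting_set F G (X \<inter> verts G)" and finX: "finite X"
      using hitting_set_subgraph[OF J(2)] J(1)
      by (auto simp: hitting_set_def simple_graph_def intro: finite_subset)
    have "\<not> (?t + 2) * s \<le> card (verts G - (X \<inter> verts G))"
      using hit minor_after_deletion[OF G(1) Hs G(3) spos] H
      unfolding hitting_set_def has_minor_from_def by blast
    moreover have "card (verts G) \<le> card (verts G - (X \<inter> verts G)) + card X"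
    proof -
      have "card (verts G) \<le> card ((verts G - (X \<inter> verts G)) \<union> X)"
        using finX G(2) by (intro card_mono) auto
      also have "\<dots> \<le> card (verts G - (X \<inter> verts G)) + card X" by (rule card_Un_le)
      finally show ?thesis .
    qed
    moreover have "card (verts G) = 2 * ((?t + 2) * s)" using G(2) ns by simp
    ultimately show "(?t + 2) * s \<le> card X" by linarith
  qed
  then have "k * l \<le> 8 * covering_number F J" using n_ge ns by linarith
  then show ?thesis using J by blast
qed

theorem mainTheorem3:
  fixes \<F> :: "'a ugraph set"
  assumes "finite \<F>"
    and "\<forall>H\<in>\<F>. simple_graph H"
    and "\<exists>H\<in>\<F>. planar H"
    and "\<forall>H\<in>\<F>. \<not> forest H"
  shows "\<exists>c::real. c > 0 \<and> (\<exists>k0::nat. \<forall>k\<ge>k0. \<exists>G :: nat ugraph.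
           simple_graph G \<and> packing_number \<F> G = k \<and>
           real (covering_number \<F> G) \<ge> c * real k * ln (real k))"
proof -
  obtain H where H: "H \<in> \<F>" using assms(3) by blast
  have F: "simple_graph H \<and> \<not> forest H" if "H \<in> \<F>" for H using assms(2,4) that by blast
  define d where "d = 3 * (2 * (card (verts H) + 2)) ^ 2"
  have d4: "4 \<le> d"
  proof -
    have "(2::nat) ^ 2 \<le> (2 * (card (verts H) + 2)) ^ 2" by (rule power_mono) simp_all
    then show ?thesis by (simp add: d_def)
  qed
  have lnd: "0 < ln (real d)" using d4 by simp
  \<comment> \<open>covers have size at least \<^term>\<open>k * l / 8\<close>, where \<^term>\<open>ln k \<le> 4 * l * ln d\<close>\<close>
  define c where "c = 1 / (32 * ln (real d))"
  have "\<exists>G :: nat ugraph. simple_graph G \<and> packing_number \<F> G = k \<and>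
           real (covering_number \<F> G) \<ge> c * real k * ln (real k)" if k: "d ^ 2 \<le> k" for k
  proof -
    have "d * 4 \<le> d ^ 2" using d4 by (simp add: power2_eq_square)
    then have k4: "4 * d \<le> k" and k1: "1 \<le> k" using k d4 by auto
    have "2 \<le> d ^ 2" using d4 \<open>d * 4 \<le> d ^ 2\<close> by simp
    then obtain l where l: "(d ^ 2) ^ l \<le> k" "k < (d ^ 2) ^ (l + 1)"
      using ex_power_ivl1[of "d ^ 2" k] k1 by blast
    have l1: "1 \<le> l" using l(2) k by (cases l) auto
    have "d ^ (2 * l) \<le> k" using l(1) by (simp add: power_mult)
    then obtain G :: "nat ugraph" where G: "simple_graph G" "packing_number \<F> G = k"
        and cov: "k * l \<le> 8 * covering_number \<F> G"
      using packing_covering_gap[OF F H d_def l1 _ k4] by blast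
    have "real k \<le> real ((d ^ 2) ^ (l + 1))" using l(2) by (intro of_nat_mono) simp
    also have "\<dots> = real d ^ (2 * (l + 1))" by (simp only: power_mult of_nat_power)
    finally have "ln (real k) \<le> ln (real d ^ (2 * (l + 1)))"
      by (rule ln_mono) (use k1 in simp)
    also have "\<dots> = real (2 * (l + 1)) * ln (real d)" by (rule ln_realpow)
    also have "\<dots> \<le> 4 * real l * ln (real d)"
      using l1 lnd by (intro mult_right_mono) auto
    finally have "c * real k * ln (real k) \<le> c * real k * (4 * real l * ln (real d))"
      using lnd by (intro mult_left_mono) (auto simp: c_def)
    also have "\<dots> = real (k * l) / 8" using lnd by (simp add: c_def)
    also have "\<dots> \<le> real (covering_number \<F> G)" using cov by (simp flip: of_nat_mult)
    finally show ?thesis using G by blast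
  qed
  moreover have "0 < c" using lnd by (simp add: c_def)
  ultimately show ?thesis by blast
qed

end
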